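(* Let $X,Y$ be Banach spaces, $\Omega\subseteq X$ a non-empty open convex set, $t:\Omega\to Y$ a Fréchet differentiable operator, $r>0$ and $V(x^*,r)\subseteq\Omega$. Suppose that $t(x^* )=0$, $t$ has a continuous derivative in $V(x^*,r)$, $[t'(x^* )]^{-1}$ exists, and $[t'(x^* )]^{-1}t'$ satisfies the center Lipschitz condition with the $L$-average $$\|[t'(x^* )]^{-1}(t'(x)-t'(x^* ))\|\le\int_0^{2\rho(x)}L(u)\,du\qquad\forall\,x\in V(x^*,r),$$ where $\rho(x)=\|x-x^*\|$ and $L$ is a positive integrable function on $(0,2r)$. Let $r$ satisfy $$\frac{\int_0^{2r}L(u)(2r-u)\,du}{2r}\le1.$$ Then the equation $t(x)=0$ has a unique solution $x^*$ in $V(x^*,r)$.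
   Context: $V(x^*,r)=\{x:\|x-x^*\|<r\}$ is the open ball. *)

theory Defs
  imports "HOL-Analysis.Analysis"
begin

end

theory Submission
  imports Defs
begin

text \<open>
  Write \<open>d = \<parallel>y - xs\<parallel>\<close> for a second zero \<open>y\<close> in the ball. The map
  \<open>g s = Tinv (t (xs + s (y - xs))) - s (y - xs)\<close> measures by how much the preconditioned
  operator differs from its linearisation at \<open>xs\<close>. It vanishes at \<open>s = 0\<close>, and at \<open>s = 1\<close> it
  has norm \<open>d\<close> because \<open>t y = 0\<close>. Its derivative is bounded, through the center Lipschitz
  condition, by \<open>d\<close> times the integral of \<open>L\<close> over \<open>(0, 2 s d)\<close>.

  That bound is the derivative in \<open>s\<close> of half the ramp integral
  \<open>K \<tau> = \<integral> L u * max 0 (\<tau> - u) du\<close> at \<open>\<tau> = 2 d s\<close>. This is proved in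
  \<open>has_real_derivative_ramp_integral\<close> by differentiating under the integral sign, which takes
  the place of exchanging the integrals over \<open>s\<close> and \<open>u\<close>. The mean value inequality
  therefore gives \<open>d \<le> K (2 d) / 2\<close>, that is, \<open>1 \<le> K (2 d) / (2 d)\<close>.

  On the other hand \<open>K \<tau> / \<tau>\<close> is the integral of \<open>L u * max 0 (1 - u / \<tau>)\<close>, which grows
  strictly with \<open>\<tau>\<close> as \<open>L\<close> is positive (\<open>ramp_integral_average_less\<close>). As \<open>d < r\<close>, this gives
  \<open>K (2 d) / (2 d) < K (2 r) / (2 r) \<le> 1\<close>, a contradiction.
\<close>

lemma integrable_mult_ramp:
  fixes M :: "real \<Rightarrow> real"
  assumes M: "integrable lebesgue M" and supp: "\<And>u. u \<le> 0 \<Longrightarrow> M u = 0"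
  shows "integrable lebesgue (\<lambda>u. M u * max 0 (\<tau> - u))"
proof (rule Bochner_Integration.integrable_bound[where f = "\<lambda>u. \<bar>\<tau>\<bar> * M u"])
  show "integrable lebesgue (\<lambda>u. \<bar>\<tau>\<bar> * M u)" using M by simp
  have "(\<lambda>u. max 0 (\<tau> - u)) \<in> borel_measurable lebesgue"
    by (rule measurable_completion) simp
  then show "(\<lambda>u. M u * max 0 (\<tau> - u)) \<in> borel_measurable lebesgue"
    using M by (intro borel_measurable_times) auto
  have "\<bar>M u\<bar> * \<bar>max 0 (\<tau> - u)\<bar> \<le> \<bar>M u\<bar> * \<bar>\<tau>\<bar>" for u
    using supp[of u] by (cases "u \<le> 0") (auto intro!: mult_left_mono)
  then show "AE u in lebesgue. norm (M u * max 0 (\<tau> - u)) \<le> norm (\<bar>\<tau>\<bar> * M u)"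
    by (auto simp: abs_mult mult.commute)
qed

text \<open>
  The difference quotients of the ramp \<open>\<lambda>\<tau>. max 0 (\<tau> - u)\<close> are bounded by 1 and converge, away
  from the kink \<open>u = x\<close>, to the indicator of \<open>u < x\<close>; so dominated convergence applies with
  majorant \<open>\<bar>M\<bar>\<close>, the kink being a null set. Every \<open>x\<close> is therefore a point of
  differentiability, whereas the integral of \<open>M\<close> itself is differentiable only almost everywhere.
\<close>

lemma has_real_derivative_ramp_integral:
  fixes M :: "real \<Rightarrow> real"
  assumes M: "integrable lebesgue M" and supp: "\<And>u. u \<le> 0 \<Longrightarrow> M u = 0"
  shows "((\<lambda>\<tau>. LINT u|lebesgue. M u * max 0 (\<tau> - u)) has_real_derivative
           (LINT u|lebesgue. M u * indicator {..<x} u)) (at x)"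
  unfolding has_field_derivative_iff tendsto_at_iff_sequentially
proof (intro allI impI)
  fix X :: "nat \<Rightarrow> real"
  assume X: "\<forall>i. X i \<in> UNIV - {x}" and lim: "X \<longlonglongrightarrow> x"
  define q where "q i u = (max 0 (X i - u) - max 0 (x - u)) / (X i - x)" for i u
  have meas: "(\<lambda>u. M u * q i u) \<in> borel_measurable lebesgue" for i
  proof -
    have "q i \<in> borel_measurable lebesgue"
      unfolding q_def by (rule measurable_completion) simp
    then show ?thesis using M by (intro borel_measurable_times) auto
  qed
  have bound: "\<bar>q i u\<bar> \<le> 1" for i u
    using X by (auto simp: q_def abs_le_iff divide_simps max_def)
  have ptw: "(\<lambda>i. q i u) \<longlonglongrightarrow> indicator {..<x} u" if "u \<noteq> x" for u
  proof (cases "u < x")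
    case True
    have "\<forall>\<^sub>F i in sequentially. q i u = 1"
      using order_tendstoD(1)[OF lim True]
    proof eventually_elim
      case (elim i)
      then show ?case using X True by (auto simp: q_def max_def)
    qed
    then show ?thesis using True by (simp add: tendsto_eventually)
  next
    case False
    with that have "x < u" by simp
    have "\<forall>\<^sub>F i in sequentially. q i u = 0"
      using order_tendstoD(2)[OF lim \<open>x < u\<close>]
      by eventually_elim (use \<open>x < u\<close> in \<open>auto simp: q_def max_def\<close>)
    then show ?thesis using False by (simp add: tendsto_eventually)
  qed
  have "(\<lambda>i. LINT u|lebesgue. M u * q i u) \<longlonglongrightarrow> (LINT u|lebesgue. M u * indicator {..<x} u)"
  proof (rule integral_dominated_convergence[where w = "\<lambda>u. \<bar>M u\<bar>"])
    show "(\<lambda>u. M u * indicator {..<x} u) \<in> borel_measurable lebesgue"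
      using M by (intro borel_measurable_times borel_measurable_indicator) auto
    show "integrable lebesgue (\<lambda>u. \<bar>M u\<bar>)" using M by simp
    have "AE u in lebesgue. u \<noteq> x"
      by (rule AE_completion) (rule AE_lborel_singleton)
    then show "AE u in lebesgue. (\<lambda>i. M u * q i u) \<longlonglongrightarrow> M u * indicator {..<x} u"
      by eventually_elim (intro tendsto_intros ptw)
    show "AE u in lebesgue. norm (M u * q i u) \<le> \<bar>M u\<bar>" for i
      using bound[of i] by (auto simp: abs_mult intro!: mult_left_le)
  qed (rule meas)
  moreover have "(LINT u|lebesgue. M u * q i u) =
      ((LINT u|lebesgue. M u * max 0 (X i - u)) - (LINT u|lebesgue. M u * max 0 (x - u))) / (X i - x)" for i
  proof -
    have "(LINT u|lebesgue. M u * q i u) =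
        (LINT u|lebesgue. (M u * max 0 (X i - u) - M u * max 0 (x - u)) / (X i - x))"
      by (rule Bochner_Integration.integral_cong) (simp_all add: q_def algebra_simps)
    also have "\<dots> = (LINT u|lebesgue. M u * max 0 (X i - u) - M u * max 0 (x - u)) / (X i - x)"
      by (rule integral_divide_zero)
    also have "\<dots> = ((LINT u|lebesgue. M u * max 0 (X i - u)) -
        (LINT u|lebesgue. M u * max 0 (x - u))) / (X i - x)"
      by (subst Bochner_Integration.integral_diff) (auto intro: integrable_mult_ramp[OF M supp])
    finally show ?thesis .
  qed
  ultimately show "((\<lambda>y. ((LINT u|lebesgue. M u * max 0 (y - u)) -
      (LINT u|lebesgue. M u * max 0 (x - u))) / (y - x)) \<circ> X) \<longlonglongrightarrow>
      (LINT u|lebesgue. M u * indicator {..<x} u)"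
    by (simp add: o_def)
qed

text \<open>
  For each \<open>u > 0\<close> the kernel \<open>max 0 (\<tau> - u) / \<tau> = max 0 (1 - u / \<tau>)\<close> is nondecreasing in
  \<open>\<tau>\<close>, and it increases strictly from \<open>a\<close> to \<open>b\<close> when \<open>u < b\<close>. So the weighted kernels differ
  by a nonnegative function that is positive on a set of positive measure.
\<close>

lemma ramp_integral_average_less:
  fixes M :: "real \<Rightarrow> real"
  assumes M: "integrable lebesgue M" and supp: "\<And>u. u \<le> 0 \<Longrightarrow> M u = 0"
    and nonneg: "\<And>u. M u \<ge> 0" and pos: "\<And>u. u \<in> {0<..<b} \<Longrightarrow> M u > 0"
    and ab: "0 < a" "a < b"
  shows "(LINT u|lebesgue. M u * max 0 (a - u)) / a < (LINT u|lebesgue. M u * max 0 (b - u)) / b"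
proof -
  define D where "D u = M u * max 0 (b - u) / b - M u * max 0 (a - u) / a" for u
  have int: "integrable lebesgue (\<lambda>u. M u * max 0 (\<tau> - u) / \<tau>)" for \<tau>
    using integrable_mult_ramp[OF M supp] by simp
  have D_int: "integrable lebesgue D"
    unfolding D_def by (rule Bochner_Integration.integrable_diff[OF int int])
  have D_eq: "D u = M u * (max 0 (b - u) / b - max 0 (a - u) / a)" for u
    by (simp add: D_def algebra_simps)
  have kernel: "max 0 (a - u) / a \<le> max 0 (b - u) / b" if "u > 0" for u
    using that ab by (auto simp: max_def divide_simps algebra_simps)
  have kernel_less: "max 0 (a - u) / a < max 0 (b - u) / b" if "0 < u" "u < b" for u
    using that ab by (auto simp: max_def divide_simps algebra_simps)
  have D_nonneg: "D u \<ge> 0" for u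
    using kernel[of u] nonneg[of u] supp[of u] by (cases "u > 0") (auto simp: D_eq)
  have D_pos: "D u > 0" if "u \<in> {0<..<b}" for u
    using that pos[OF that] kernel_less[of u] by (simp add: D_eq)
  have "(LINT u|lebesgue. D u) \<noteq> 0"
  proof
    assume "(LINT u|lebesgue. D u) = 0"
    then have "AE u in lebesgue. D u = 0"
      using integral_nonneg_eq_0_iff_AE[OF D_int] D_nonneg by simp
    then have "AE u in lebesgue. u \<notin> {0<..<b}"
      by eventually_elim (use D_pos in force)
    then have "{0<..<b} \<in> null_sets lebesgue"
      using AE_iff_null_sets[of "{0<..<b}" lebesgue] by simp
    then show False using ab by (auto simp: null_sets_def)
  qed
  moreover have "(LINT u|lebesgue. D u) \<ge> 0"
    using D_nonneg by simp
  moreover have "(LINT u|lebesgue. D u) =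
      (LINT u|lebesgue. M u * max 0 (b - u)) / b - (LINT u|lebesgue. M u * max 0 (a - u)) / a"
    unfolding D_def by (subst Bochner_Integration.integral_diff[OF int int]) simp
  ultimately show ?thesis by simp
qed

theorem theorem4p1:
  fixes t :: "'a::banach \<Rightarrow> 'b::banach"
    and t' :: "'a \<Rightarrow> 'a \<Rightarrow>\<^sub>L 'b"
    and Tinv :: "'b \<Rightarrow>\<^sub>L 'a"
    and \<Omega> :: "'a set"
    and xs :: 'a
    and r :: real
    and L :: "real \<Rightarrow> real"
  assumes "\<Omega> \<noteq> {}" and "open \<Omega>" and "convex \<Omega>"
    and deriv: "\<And>x. x \<in> \<Omega> \<Longrightarrow> (t has_derivative blinfun_apply (t' x)) (at x)"
    and "r > 0" and "ball xs r \<subseteq> \<Omega>"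
    and "t xs = 0"
    and cont: "continuous_on (ball xs r) t'"
    and inv_left: "Tinv o\<^sub>L t' xs = id_blinfun"
    and inv_right: "t' xs o\<^sub>L Tinv = id_blinfun"
    and L_pos: "\<And>u. u \<in> {0<..<2 * r} \<Longrightarrow> L u > 0"
    and L_int: "set_integrable lebesgue {0<..<2 * r} L"
    and center_Lipschitz: "\<And>x. x \<in> ball xs r \<Longrightarrow>
          norm (Tinv o\<^sub>L (t' x - t' xs)) \<le> (LINT u:{0<..<2 * norm (x - xs)}|lebesgue. L u)"
    and radius: "(LINT u:{0<..<2 * r}|lebesgue. L u * (2 * r - u)) / (2 * r) \<le> 1"
  shows "{x \<in> ball xs r. t x = 0} = {xs}"
proof -
  \<comment> \<open>The values of \<open>L\<close> outside the interval are arbitrary, so the ramp integrals are formed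
    with its extension by zero.\<close>
  define M where "M u = indicator {0<..<2 * r} u * L u" for u
  have M: "integrable lebesgue M"
    using L_int by (simp add: set_integrable_def M_def[abs_def])
  have supp: "M u = 0" if "u \<le> 0" for u using that by (simp add: M_def)
  have M_pos: "M u > 0" if "u \<in> {0<..<2 * r}" for u using that L_pos by (simp add: M_def)
  have M_nonneg: "M u \<ge> 0" for u
    using L_pos[of u] by (auto simp: M_def indicator_def)
  define K where "K \<tau> = (LINT u|lebesgue. M u * max 0 (\<tau> - u))" for \<tau>
  define G where "G \<tau> = (LINT u|lebesgue. M u * indicator {..<\<tau>} u)" for \<tau>
  have K_deriv: "(K has_real_derivative G \<tau>) (at \<tau>)" for \<tau>
    using has_real_derivative_ramp_integral[OF M supp] unfolding K_def G_def .
  have G_eq: "(LINT u:{0<..<\<tau>}|lebesgue. L u) = G \<tau>" if "\<tau> \<le> 2 * r" for \<tau>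
    unfolding set_lebesgue_integral_def G_def
    by (rule Bochner_Integration.integral_cong) (use that in \<open>auto simp: M_def indicator_def\<close>)
  have "(LINT u:{0<..<2 * r}|lebesgue. L u * (2 * r - u)) = K (2 * r)"
    unfolding set_lebesgue_integral_def K_def
    by (rule Bochner_Integration.integral_cong) (auto simp: M_def indicator_def)
  then have radius': "K (2 * r) / (2 * r) \<le> 1" using radius by simp

  have "y = xs" if y: "y \<in> ball xs r" "t y = 0" for y
  proof (rule ccontr)
    assume "y \<noteq> xs"
    define d where "d = norm (y - xs)"
    have d: "0 < d" "d < r"
      using y \<open>y \<noteq> xs\<close> by (auto simp: d_def dist_norm norm_minus_commute)
    define p where "p s = xs + s *\<^sub>R (y - xs)" for s
    have p_dist: "norm (p s - xs) = s * d" if "0 \<le> s" for s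
      using that by (simp add: p_def d_def)
    have p_ball: "p s \<in> ball xs r" if "0 \<le> s" "s \<le> 1" for s
    proof -
      have "s * d \<le> d" using that d by (simp add: mult_left_le_one_le)
      then have "norm (p s - xs) < r" using p_dist[OF that(1)] d by linarith
      then show ?thesis by (simp add: dist_norm norm_minus_commute)
    qed
    define g where "g s = Tinv (t (p s)) - s *\<^sub>R (y - xs)" for s
    define g' where "g' s = (Tinv o\<^sub>L (t' (p s) - t' xs)) (y - xs)" for s
    have Tinv_t': "Tinv (t' xs v) = v" for v
      using arg_cong[OF inv_left, of "\<lambda>f. blinfun_apply f v"] by simp
    have g_deriv: "(g has_vector_derivative g' s) (at s)" if "0 \<le> s" "s \<le> 1" for s
    proof -
      have "p s \<in> \<Omega>" using p_ball[OF that] \<open>ball xs r \<subseteq> \<Omega>\<close> by blast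
      have "(p has_derivative (\<lambda>h. h *\<^sub>R (y - xs))) (at s)"
        unfolding p_def by (auto intro!: derivative_eq_intros)
      from has_derivative_compose[OF this deriv[OF \<open>p s \<in> \<Omega>\<close>]]
      have "((\<lambda>s. Tinv (t (p s))) has_derivative (\<lambda>h. Tinv (t' (p s) (h *\<^sub>R (y - xs))))) (at s)"
        by (rule bounded_linear.has_derivative[OF blinfun.bounded_linear_right])
      then have "(g has_derivative
          (\<lambda>h. Tinv (t' (p s) (h *\<^sub>R (y - xs))) - h *\<^sub>R (y - xs))) (at s)"
        unfolding g_def
        by (rule has_derivative_diff) (auto intro!: derivative_eq_intros)
      moreover have "(\<lambda>h. Tinv (t' (p s) (h *\<^sub>R (y - xs))) - h *\<^sub>R (y - xs)) = (\<lambda>h. h *\<^sub>R g' s)"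
        by (simp add: g'_def blinfun.bilinear_simps Tinv_t' algebra_simps)
      ultimately show ?thesis by (simp add: has_vector_derivative_def)
    qed
    have g'_bound: "norm (g' s) \<le> d * G (2 * d * s)" if "0 \<le> s" "s \<le> 1" for s
    proof -
      have "s * d \<le> d" using that d by (simp add: mult_left_le_one_le)
      then have "2 * norm (p s - xs) \<le> 2 * r" using p_dist[OF that(1)] d by linarith
      then have "norm (Tinv o\<^sub>L (t' (p s) - t' xs)) \<le> G (2 * d * s)"
        using center_Lipschitz[OF p_ball[OF that]] G_eq p_dist[OF that(1)]
        by (simp add: mult_ac)
      moreover have "norm (g' s) \<le> norm (Tinv o\<^sub>L (t' (p s) - t' xs)) * d"
        unfolding g'_def d_def by (rule norm_blinfun)
      ultimately show ?thesis
        using d by (smt (verit) mult.commute mult_right_mono)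
    qed
    define \<phi> where "\<phi> s = K (2 * d * s) / 2" for s
    have \<phi>_deriv: "(\<phi> has_vector_derivative d * G (2 * d * s)) (at s)" for s
    proof -
      have "((\<lambda>s. K (2 * d * s)) has_real_derivative G (2 * d * s) * (2 * d)) (at s)"
        by (rule DERIV_chain2[OF K_deriv]) (auto intro!: derivative_eq_intros)
      from DERIV_cdivide[OF this, of 2] show ?thesis
        by (simp add: \<phi>_def[abs_def] has_real_derivative_iff_has_vector_derivative mult.commute)
    qed
    have "norm (g 1 - g 0) \<le> \<phi> 1 - \<phi> 0"
    proof (rule differentiable_bound_general)
      show "continuous_on {0..1} g"
        by (intro continuous_at_imp_continuous_on ballI)
           (auto intro: has_vector_derivative_continuous g_deriv)
      show "continuous_on {0..1} \<phi>"
        by (intro continuous_at_imp_continuous_on ballI)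
           (auto intro: has_vector_derivative_continuous \<phi>_deriv)
    qed (auto intro: g_deriv \<phi>_deriv g'_bound)
    moreover have "g 1 - g 0 = - (y - xs)"
      using \<open>t y = 0\<close> \<open>t xs = 0\<close> by (simp add: g_def p_def)
    moreover have "K 0 = 0"
    proof -
      have "M u * max 0 (0 - u) = 0" for u using supp[of u] by (cases "u \<le> 0") auto
      then show ?thesis unfolding K_def by (simp only: Bochner_Integration.integral_zero)
    qed
    ultimately have "1 \<le> K (2 * d) / (2 * d)"
      using d by (simp add: \<phi>_def d_def norm_minus_commute field_simps)
    also have "K (2 * d) / (2 * d) < K (2 * r) / (2 * r)"
      unfolding K_def
      by (rule ramp_integral_average_less[OF M supp M_nonneg M_pos]) (use d in auto)
    also have "\<dots> \<le> 1" by (rule radius')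
    finally show False by simp
  qed
  then show ?thesis using \<open>r > 0\<close> \<open>t xs = 0\<close> by auto
qed

end
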